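(* Let $0<a<\frac{1}{e}$ and $b>0$, and let $\mathcal{W}=\{w_i : w_i=a(i-1)+b,\ i\in\mathbb{N}\}$. Then there exists a probability distribution $P_X$ supported on $\mathcal{W}$ such that, when $X\sim P_X$ and $Y$ given $X$ follows the Poisson noise model, for all $y\in\mathbb{N}_0$ $$\mathsf{med}(X\mid Y=y)=ay+b .$$
   Context: $\mathbb{N}=\{1,2,\dots\}$, $\mathbb{N}_0=\{0,1,2,\dots\}$, and $e$ is Euler's number. A distribution is supported on $\mathcal{W}$ if it assigns probability one to $\mathcal{W}$. Poisson noise model: $X$ is a non-negative random variable with distribution (prior) $P_X$, and $Y$ is an $\mathbb{N}_0$-valued random variable with conditional law $P_{Y|X}(y|x)=\frac{1}{y!}x^y e^{-x}$ for $x\ge 0$, $y\in\mathbb{N}_0$, with the convention $0^0=1$. Conditional median: $\mathsf{med}(X\mid Y=y)=F^{-1}_{X|Y=y}(1/2)$, where $F^{-1}_{X|Y=y}$ is the left-inverse (quantile function) of the conditional cdf, i.e. $\mathsf{med}(X\mid Y=y)=\inf\{t: P[X\le t\mid Y=y]\ge 1/2\}$. *)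

theory Defs
  imports "HOL-Probability.Probability"
begin

text \<open>
  The library's \<open>poisson_pmf\<close> is only specified for a positive rate; here the rate
  \<open>x = 0\<close> is admitted as well, giving the point mass at \<open>0\<close> because \<open>0 ^ 0 = 1\<close>.
\<close>

definition poisson_likelihood :: "nat \<Rightarrow> real \<Rightarrow> real" where
  "poisson_likelihood y x = 1 / fact y * x ^ y * exp (- x)"

text \<open>
  The joint law of \<open>(X, Y)\<close>: its density with respect to the product of the prior \<open>P\<close> and the
  counting measure is the conditional probability mass function of \<open>Y\<close> given \<open>X\<close>. It is
  meaningful for priors on \<open>borel\<close> with \<open>X \<ge> 0\<close> almost surely (\<open>ennreal\<close> truncates
  negative values to \<open>0\<close>); the random variables \<open>X\<close> and \<open>Y\<close> are the two projections.
\<close>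

definition poisson_joint :: "real measure \<Rightarrow> (real \<times> nat) measure" where
  "poisson_joint P =
     density (P \<Otimes>\<^sub>M count_space UNIV) (\<lambda>(x, y). ennreal (poisson_likelihood y x))"

definition cond_cdf :: "'m measure \<Rightarrow> ('m \<Rightarrow> real) \<Rightarrow> ('m \<Rightarrow> 'b) \<Rightarrow> 'b \<Rightarrow> real \<Rightarrow> real" where
  "cond_cdf M X Y y t = \<P>(\<omega> in M. X \<omega> \<le> t \<bar> Y \<omega> = y)"

text \<open>
  \<open>Inf\<close> on \<open>real\<close> is only meaningful for nonempty sets that are bounded below. This is the
  case for every \<open>0 < p < 1\<close> when \<open>F\<close> is a genuine distribution function.
\<close>

definition quantile :: "(real \<Rightarrow> real) \<Rightarrow> real \<Rightarrow> real" where
  "quantile F p = Inf {t. F t \<ge> p}"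

definition cond_median :: "'m measure \<Rightarrow> ('m \<Rightarrow> real) \<Rightarrow> ('m \<Rightarrow> 'b) \<Rightarrow> 'b \<Rightarrow> real" where
  "cond_median M X Y y = quantile (cond_cdf M X Y y) (1/2)"

lemma poisson_likelihood_nonneg: "0 \<le> x \<Longrightarrow> 0 \<le> poisson_likelihood y x"
  by (simp add: poisson_likelihood_def)

lemma poisson_likelihood_measurable [measurable]:
  "(\<lambda>(x, y). ennreal (poisson_likelihood y x)) \<in> borel_measurable (borel \<Otimes>\<^sub>M count_space UNIV)"
  unfolding poisson_likelihood_def by (measurable; simp)

lemma poisson_likelihood_sum:
  assumes "0 \<le> x"
  shows "(\<integral>\<^sup>+ y. ennreal (poisson_likelihood y x) \<partial>count_space UNIV) = 1"
proof -
  have "(\<lambda>y. x ^ y /\<^sub>R fact y) sums exp x"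
    by (rule exp_converges)
  from sums_mult2[OF this, of "exp (- x)"]
  have "(\<lambda>y. poisson_likelihood y x) sums 1"
    by (simp add: poisson_likelihood_def divide_inverse mult.assoc flip: exp_add)
  then show ?thesis
    using poisson_likelihood_nonneg[OF assms]
    by (simp add: nn_integral_count_space_nat suminf_ennreal2 sums_iff)
qed

text \<open>
  On \<open>poisson_joint P\<close> the first projection has law \<open>P\<close>, and the second one has the Poisson
  conditional law given the first.
\<close>

lemma emeasure_poisson_joint_Times:
  assumes P: "prob_space P" "sets P = sets borel" and A: "A \<in> sets borel"
  shows "emeasure (poisson_joint P) (A \<times> B) =
    (\<integral>\<^sup>+ x. (\<integral>\<^sup>+ y. ennreal (poisson_likelihood y x) * indicator B y \<partial>count_space UNIV)
        * indicator A x \<partial>P)"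
proof -
  interpret P: prob_space P by fact
  interpret C: sigma_finite_measure "count_space (UNIV :: nat set)"
    by (rule sigma_finite_measure_count_space)
  note [measurable_cong] = P(2)
  have AP[measurable]: "A \<in> sets P" using A P(2) by simp
  have m[measurable]: "(\<lambda>(x, y). ennreal (poisson_likelihood y x))
      \<in> borel_measurable (P \<Otimes>\<^sub>M count_space UNIV)"
    by measurable
  have "emeasure (poisson_joint P) (A \<times> B) =
      (\<integral>\<^sup>+ z. (case z of (x, y) \<Rightarrow> ennreal (poisson_likelihood y x)) * indicator (A \<times> B) z
        \<partial>(P \<Otimes>\<^sub>M count_space UNIV))"
    unfolding poisson_joint_def by (rule emeasure_density) (use AP in auto)
  also have "\<dots> = (\<integral>\<^sup>+ x. \<integral>\<^sup>+ y. ennreal (poisson_likelihood y x) * indicator (A \<times> B) (x, y)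
      \<partial>count_space UNIV \<partial>P)"
    by (subst C.nn_integral_fst[symmetric]) (use AP in auto)
  also have "\<dots> = (\<integral>\<^sup>+ x. (\<integral>\<^sup>+ y. ennreal (poisson_likelihood y x) * indicator B y
      \<partial>count_space UNIV) * indicator A x \<partial>P)"
    by (intro nn_integral_cong) (auto simp: indicator_def)
  finally show ?thesis .
qed

lemma emeasure_poisson_joint_slice:
  assumes "prob_space P" "sets P = sets borel" "A \<in> sets borel"
  shows "emeasure (poisson_joint P) (A \<times> {y}) =
    (\<integral>\<^sup>+ x. ennreal (poisson_likelihood y x) * indicator A x \<partial>P)"
proof -
  have "(\<integral>\<^sup>+ z. ennreal (poisson_likelihood z x) * indicator {y} z \<partial>count_space UNIV)
      = ennreal (poisson_likelihood y x)" for x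
    by (subst nn_integral_indicator_singleton) auto
  then show ?thesis
    using assms by (simp add: emeasure_poisson_joint_Times)
qed

lemma poisson_joint_marginal:
  assumes P: "prob_space P" "sets P = sets borel" and pos: "AE x in P. 0 \<le> x"
    and A: "A \<in> sets borel"
  shows "emeasure (poisson_joint P) (A \<times> UNIV) = emeasure P A"
proof -
  have "emeasure (poisson_joint P) (A \<times> UNIV) =
      (\<integral>\<^sup>+ x. (\<integral>\<^sup>+ y. ennreal (poisson_likelihood y x) \<partial>count_space UNIV) * indicator A x \<partial>P)"
    by (simp add: emeasure_poisson_joint_Times[OF P A])
  also have "\<dots> = (\<integral>\<^sup>+ x. indicator A x \<partial>P)"
    using pos by (intro nn_integral_cong_AE, eventually_elim) (simp add: poisson_likelihood_sum)
  also have "\<dots> = emeasure P A"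
    using A P(2) by simp
  finally show ?thesis .
qed

lemma prob_space_poisson_joint:
  assumes P: "prob_space P" "sets P = sets borel" and pos: "AE x in P. 0 \<le> x"
  shows "prob_space (poisson_joint P)"
proof
  have sp: "space P = UNIV"
    using sets_eq_imp_space_eq[OF P(2)] by simp
  have "space (poisson_joint P) = UNIV \<times> UNIV"
    by (simp add: poisson_joint_def space_pair_measure sp)
  then show "emeasure (poisson_joint P) (space (poisson_joint P)) = 1"
    using poisson_joint_marginal[OF P pos, of UNIV] prob_space.emeasure_space_1[OF P(1)] sp
    by simp
qed

end

theory Submission
  imports Defs
begin

text \<open>
  Write \<open>q i = P(X = w i) * exp (- w i)\<close>. It suffices to find positive \<open>q\<close> with the exact balance
  \<open>(\<Sum>i\<le>y. q i * w i ^ y) = (\<Sum>i>y. q i * w i ^ y)\<close> for every \<open>y\<close>. For finitely many points, take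
  \<open>q\<close> to be the increments of the running maximum of a point \<open>x\<close> of the unit cube. Adding to
  ``right side minus left side'' a multiple of the excess of the running maximum over \<open>x y\<close> produces
  functions with the sign pattern of the Poincare--Miranda theorem, and at a common zero the extra
  terms vanish. Normalise \<open>q 0 = 1\<close> and write \<open>L y\<close> for the left side: the balance gives
  \<open>L (y + 1) \<le> (w y + w (y + 1)) * L y\<close>, so all moments are bounded uniformly in the number of points
  and a subsequence converges to a solution for infinitely many points. Finally
  \<open>(\<Sum>i. q i * exp (w i)) = (\<Sum>k. 2 * L k / fact k)\<close>, which is finite because \<open>2 * a < 1\<close>.
\<close>

section \<open>The Poincare--Miranda theorem\<close>

lemma tendsto_pointwise_iff:
  fixes x :: "'a \<Rightarrow> 'b::topological_space"
  shows "(X \<longlongrightarrow> x) F \<longleftrightarrow> (\<forall>j. ((\<lambda>k. X k j) \<longlongrightarrow> x j) F)"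
  using limitin_componentwise[of "\<lambda>_. euclidean" UNIV X x F]
  by (simp add: euclidean_product_topology)

text \<open>Tychonoff makes the box compact, and a countable index type makes the product first
  countable, so compactness is sequential. It serves both the cell corners below and the weights as
  the number of points grows.\<close>

lemma bounded_pointwise_convergent_subsequence:
  fixes X :: "nat \<Rightarrow> 'a::countable \<Rightarrow> real"
  assumes "\<And>k j. X k j \<in> {l j..u j}"
  obtains x r where "strict_mono r" "\<And>j. x j \<in> {l j..u j}" "(X \<circ> r) \<longlonglongrightarrow> x"
proof -
  have "compactin (product_topology (\<lambda>_. euclidean) UNIV) (PiE UNIV (\<lambda>j. {l j..u j}))"
    by (subst compactin_PiE) auto
  then have "compact (PiE UNIV (\<lambda>j. {l j..u j}))"
    unfolding euclidean_product_topology by simp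
  then have "seq_compact (PiE UNIV (\<lambda>j. {l j..u j}))"
    by (rule compact_imp_seq_compact)
  moreover have "\<forall>k. X k \<in> PiE UNIV (\<lambda>j. {l j..u j})"
    using assms by auto
  ultimately obtain x r where "x \<in> PiE UNIV (\<lambda>j. {l j..u j})" "strict_mono r" "(X \<circ> r) \<longlonglongrightarrow> x"
    by (rule seq_compactE)
  then show thesis by (intro that[of r x]) (auto simp: PiE_iff)
qed

text \<open>Kuhn's combinatorial lemma on ever finer grids yields cells on which every
  \<open>f i\<close> takes both signs; a limit of such cells is a common zero. Points are sequences
  on all of \<open>nat\<close>, with \<open>n\<close> active coordinates.\<close>

theorem poincare_miranda:
  fixes f :: "nat \<Rightarrow> (nat \<Rightarrow> real) \<Rightarrow> real"
  defines "cube \<equiv> {x. \<forall>j. x j \<in> {0..1}}"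
  assumes cont: "\<And>i. i < n \<Longrightarrow> continuous_on cube (f i)"
    and lower: "\<And>i x. i < n \<Longrightarrow> x \<in> cube \<Longrightarrow> x i = 0 \<Longrightarrow> f i x \<ge> 0"
    and upper: "\<And>i x. i < n \<Longrightarrow> x \<in> cube \<Longrightarrow> x i = 1 \<Longrightarrow> f i x \<le> 0"
  shows "\<exists>x\<in>cube. \<forall>i<n. f i x = 0"
proof -
  define g :: "nat \<Rightarrow> (nat \<Rightarrow> nat) \<Rightarrow> nat \<Rightarrow> real"
    where "g p z = (\<lambda>j. if j < n then real (z j) / real (Suc p) else 0)" for p z
  have g_cube: "g p z \<in> cube" if "\<forall>j<n. z j \<le> Suc p" for p z
    using that by (auto simp: g_def cube_def divide_simps)
  have "\<exists>q. (\<forall>i<n. q i < Suc p) \<and> (\<forall>i<n. \<exists>u v.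
      (\<forall>j<n. q j \<le> u j \<and> u j \<le> q j + 1) \<and> (\<forall>j<n. q j \<le> v j \<and> v j \<le> q j + 1) \<and>
      f i (g p u) \<ge> 0 \<and> f i (g p v) \<le> 0)" for p
  proof -
    \<comment> \<open>\<open>kuhn_lemma\<close> prescribes the labels on opposite faces;
      \<open>lower\<close> and \<open>upper\<close> make the prescribed label agree with the sign of
      \<open>f i\<close>, up to zeros.\<close>
    define label where "label z i =
      (if z i = Suc p then 1 else if z i = 0 \<or> f i (g p z) \<ge> 0 then 0 else 1 :: nat)" for z i
    have label0: "f i (g p z) \<ge> 0" if "i < n" "\<forall>j<n. z j \<le> Suc p" "label z i = 0" for z i
      using that lower[of i "g p z"] g_cube[of z p]
      by (auto simp: label_def g_def split: if_splits)
    have label1: "f i (g p z) \<le> 0" if "i < n" "\<forall>j<n. z j \<le> Suc p" "label z i \<noteq> 0" for z i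
      using that upper[of i "g p z"] g_cube[of z p]
      by (auto simp: label_def g_def split: if_splits)
    obtain q where q: "\<forall>i<n. q i < Suc p" "\<forall>i<n. \<exists>r s. (\<forall>j<n. q j \<le> r j \<and> r j \<le> q j + 1) \<and>
        (\<forall>j<n. q j \<le> s j \<and> s j \<le> q j + 1) \<and> label r i \<noteq> label s i"
      by (rule kuhn_lemma[of "Suc p" n label]) (auto simp: label_def)
    have "\<exists>u v. (\<forall>j<n. q j \<le> u j \<and> u j \<le> q j + 1) \<and> (\<forall>j<n. q j \<le> v j \<and> v j \<le> q j + 1) \<and>
      f i (g p u) \<ge> 0 \<and> f i (g p v) \<le> 0" if i: "i < n" for i
    proof -
      obtain r s where rs: "\<forall>j<n. q j \<le> r j \<and> r j \<le> q j + 1"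
        "\<forall>j<n. q j \<le> s j \<and> s j \<le> q j + 1" "label r i \<noteq> label s i"
        using q(2) i by blast
      have le: "\<forall>j<n. r j \<le> Suc p" "\<forall>j<n. s j \<le> Suc p"
        using rs(1,2) q(1) by (auto simp: Suc_le_eq) (meson le_trans less_eq_Suc_le)+
      show ?thesis
      proof (cases "label r i = 0")
        case True
        with rs le i label0[of i r] label1[of i s] show ?thesis by metis
      next
        case False
        with rs have "label s i = 0" by (auto simp: label_def split: if_splits)
        with False rs le i label0[of i s] label1[of i r] show ?thesis by metis
      qed
    qed
    with q(1) show ?thesis by blast
  qed
  then obtain q where q: "\<And>p i. i < n \<Longrightarrow> q p i < Suc p"
    and near: "\<And>p i. i < n \<Longrightarrow> \<exists>u v.
      (\<forall>j<n. q p j \<le> u j \<and> u j \<le> q p j + 1) \<and> (\<forall>j<n. q p j \<le> v j \<and> v j \<le> q p j + 1) \<and>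
      f i (g p u) \<ge> 0 \<and> f i (g p v) \<le> 0"
    by metis
  have "g p (q p) \<in> cube" for p
    using g_cube q by (meson less_imp_le)
  then have "g p (q p) j \<in> {0..1}" for p j
    by (auto simp: cube_def)
  from bounded_pointwise_convergent_subsequence[of "\<lambda>p. g p (q p)", OF this]
  obtain x r where r: "strict_mono r" and x: "\<And>j. x j \<in> {0..1}"
    and lim: "((\<lambda>p. g p (q p)) \<circ> r) \<longlonglongrightarrow> x"
    by blast
  have x_cube: "x \<in> cube" using x by (simp add: cube_def)
  \<comment> \<open>Cells have side \<open>1 / (p + 1)\<close>, so every choice of corners
    \<open>h\<close> has the same limit \<open>x\<close> as the base corners.\<close>
  have lim_near: "(\<lambda>p. f i (g (r p) (h (r p)))) \<longlonglongrightarrow> f i x"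
    if i: "i < n" and h: "\<And>p j. j < n \<Longrightarrow> q p j \<le> h p j \<and> h p j \<le> q p j + 1" for h i
  proof -
    have "(\<lambda>p. g p (h p) j - g p (q p) j) \<longlonglongrightarrow> 0" for j
    proof (rule Lim_null_comparison[OF _ LIMSEQ_inverse_real_of_nat], rule always_eventually, rule allI)
      fix p
      show "norm (g p (h p) j - g p (q p) j) \<le> inverse (real (Suc p))"
      proof (cases "j < n")
        case True
        have "g p (h p) j - g p (q p) j = (real (h p j) - real (q p j)) / real (Suc p)"
          using True by (simp add: g_def diff_divide_distrib)
        moreover have "\<bar>real (h p j) - real (q p j)\<bar> \<le> 1"
          using h[OF True, of p] by linarith
        ultimately show ?thesis by (simp add: abs_divide divide_simps)
      qed (simp add: g_def)
    qed
    from LIMSEQ_subseq_LIMSEQ[OF this r]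
    have "(\<lambda>p. g (r p) (q (r p)) j + (g (r p) (h (r p)) j - g (r p) (q (r p)) j)) \<longlonglongrightarrow> x j + 0" for j
      using lim by (intro tendsto_add) (auto simp: tendsto_pointwise_iff o_def)
    then have "(\<lambda>p. g (r p) (h (r p))) \<longlonglongrightarrow> x"
      by (simp add: tendsto_pointwise_iff)
    moreover have "g p (h p) \<in> cube" for p
    proof (intro g_cube allI impI)
      fix j assume "j < n"
      with h[of j p] q[of j p] show "h p j \<le> Suc p" by linarith
    qed
    ultimately show ?thesis
      by (intro continuous_on_tendsto_compose[OF cont[OF i]] always_eventually x_cube) auto
  qed
  have "f i x = 0" if i: "i < n" for i
  proof -
    from near[OF i] obtain u v where
      u: "\<And>p j. j < n \<Longrightarrow> q p j \<le> u p j \<and> u p j \<le> q p j + 1" "\<And>p. f i (g p (u p)) \<ge> 0" and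
      v: "\<And>p j. j < n \<Longrightarrow> q p j \<le> v p j \<and> v p j \<le> q p j + 1" "\<And>p. f i (g p (v p)) \<le> 0"
      by metis
    have "f i x \<ge> 0"
      by (rule LIMSEQ_le_const[OF lim_near[OF i, of u]]) (use u in auto)
    moreover have "f i x \<le> 0"
      by (rule LIMSEQ_le_const2[OF lim_near[OF i, of v]]) (use v in auto)
    ultimately show ?thesis by simp
  qed
  with x_cube show ?thesis by blast
qed

section \<open>Balanced weights\<close>

primrec running_max :: "(nat \<Rightarrow> 'a::linorder) \<Rightarrow> nat \<Rightarrow> 'a" where
  "running_max x 0 = x 0"
| "running_max x (Suc y) = max (running_max x y) (x (Suc y))"

lemma running_max_ge: "x y \<le> running_max x y"
  by (cases y) auto

lemma running_max_le: "(\<And>j. x j \<le> u) \<Longrightarrow> running_max x y \<le> u"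
  by (induction y) auto

lemma continuous_on_running_max:
  "continuous_on S (\<lambda>x. running_max (x :: nat \<Rightarrow> real) y)"
  by (induction y)
    (auto intro!: continuous_on_max continuous_on_subset[OF continuous_on_product_coordinates])

text \<open>All but the top point satisfy \<open>w i \<le> w y\<close>. This gives the growth bound
  on the moments and, when \<open>q (Suc y) = 0\<close>, growth by a factor of at most
  \<open>w y\<close>.\<close>

lemma moment_Suc_le:
  fixes q w :: "nat \<Rightarrow> real"
  assumes "mono w" "\<And>i. 0 < w i" "\<And>i. 0 \<le> q i"
  shows "(\<Sum>i\<le>Suc y. q i * w i ^ Suc y) \<le> w y * (\<Sum>i\<le>y. q i * w i ^ y) + q (Suc y) * w (Suc y) ^ Suc y"
proof -
  have "q i * w i ^ Suc y \<le> w y * (q i * w i ^ y)" if "i \<le> y" for i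
    using mult_right_mono[OF monoD[OF assms(1) that], of "q i * w i ^ y"] assms(2)[of i] assms(3)[of i]
    by (simp add: mult_ac)
  then show ?thesis
    by (auto simp: sum_distrib_left simp del: power_Suc intro!: sum_mono)
qed

theorem finite_balanced_weights:
  fixes w :: "nat \<Rightarrow> real"
  assumes w: "mono w" "\<And>i. 0 < w i" and N: "0 < N"
  obtains q where "\<And>i. 0 \<le> q i" "\<And>i. N < i \<Longrightarrow> q i = 0" "q 0 = 1"
    "\<And>y. y < N \<Longrightarrow> (\<Sum>i\<le>y. q i * w i ^ y) = (\<Sum>i=Suc y..N. q i * w i ^ y)"
proof -
  define cube :: "(nat \<Rightarrow> real) set" where "cube = {x. \<forall>j. x j \<in> {0..1}}"
  \<comment> \<open>Replacing the running maximum by 1 at index \<open>N\<close> makes the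
    increments telescope to total mass 1.\<close>
  define q where "q x i = (if i < N then running_max x i else if i = N then 1 else 0) -
    (if i = 0 \<or> N < i then 0 else running_max x (i - 1))" for x :: "nat \<Rightarrow> real" and i
  define L where "L x y = (\<Sum>i\<le>y. q x i * w i ^ y)" for x y
  define U where "U x y = (\<Sum>i=Suc y..N. q x i * w i ^ y)" for x y
  \<comment> \<open>The factor \<open>w y ^ y\<close> is large enough for the excess to dominate
    \<open>L x y\<close> when \<open>x y = 0\<close>, because \<open>L x y\<close> is at most
    \<open>w y ^ y * running_max x y\<close>.\<close>
  define f where "f y x = U x y - L x y + w y ^ y * (running_max x y - x y)" for x y
  have q_nonneg: "0 \<le> q x i" if "x \<in> cube" for x i
  proof (cases i)
    case 0
    then show ?thesis using that N by (auto simp: q_def cube_def)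
  next
    case (Suc j)
    then show ?thesis
      using running_max_le[of x 1 j] that by (auto simp: q_def cube_def)
  qed
  have sum_q: "(\<Sum>i\<le>y. q x i) = running_max x y" if "y < N" for x y
    using that by (induction y) (auto simp: q_def)
  have L_nonneg: "0 \<le> L x y" and U_nonneg: "0 \<le> U x y" if "x \<in> cube" for x y
    using q_nonneg[OF that] w(2) unfolding L_def U_def
    by (auto intro!: sum_nonneg mult_nonneg_nonneg simp: less_imp_le)
  have L_le: "L x y \<le> w y ^ y * running_max x y" if "x \<in> cube" "y < N" for x y
  proof -
    have "L x y \<le> (\<Sum>i\<le>y. q x i * w y ^ y)"
      unfolding L_def using q_nonneg[OF that(1)] w(2) monoD[OF w(1)]
      by (intro sum_mono mult_left_mono power_mono) (auto simp: less_imp_le)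
    then show ?thesis
      using sum_q[OF that(2), of x] by (simp add: mult.commute flip: sum_distrib_right)
  qed
  have cont: "continuous_on cube (f y)" for y
  proof -
    have "continuous_on cube (\<lambda>x. q x i)" for i
      unfolding q_def
      by (intro continuous_on_diff; cases "i < N"; cases "i = N"; cases "i = 0 \<or> N < i")
        (auto intro: continuous_on_running_max continuous_on_subset[OF continuous_on_product_coordinates])
    then show ?thesis
      unfolding f_def L_def U_def
      by (intro continuous_intros continuous_on_running_max
          continuous_on_subset[OF continuous_on_product_coordinates]) auto
  qed
  have "\<exists>x\<in>cube. \<forall>y<N. f y x = 0"
    unfolding cube_def
  proof (rule poincare_miranda, unfold cube_def[symmetric])
    show "continuous_on cube (f y)" for y by (rule cont)
    fix y x assume y: "y < N" and x: "x \<in> cube"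
    show "0 \<le> f y x" if "x y = 0"
      using L_le[OF x y] U_nonneg[OF x, of y] that by (simp add: f_def)
    show "f y x \<le> 0" if "x y = 1"
    proof -
      \<comment> \<open>At \<open>x y = 1\<close> the running maximum has reached its ceiling, so no
        weight is left beyond \<open>y\<close> and the right side is zero.\<close>
      have c: "running_max x j = 1" if "y \<le> j" for j
        using that
      proof (induction j rule: dec_induct)
        case base
        show ?case using running_max_ge[of x y] \<open>x y = 1\<close> running_max_le[of x 1 y] x
          by (auto simp: cube_def)
      next
        case (step j)
        then show ?case using x by (simp add: cube_def max_absorb1)
      qed
      then have "q x i = 0" if "y < i" for i
        using that by (auto simp: q_def)
      then have "U x y = 0" by (simp add: U_def)
      then show ?thesis using L_nonneg[OF x] c[of y] that by (simp add: f_def)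
    qed
  qed
  then obtain x where x: "x \<in> cube" and f0: "\<And>y. y < N \<Longrightarrow> f y x = 0" by blast
  \<comment> \<open>Wherever the running maximum exceeds \<open>x\<close>, the weight \<open>q\<close> vanishes, so
    the balance at \<open>y\<close> can only improve on the one at \<open>y - 1\<close>.\<close>
  have U_le_L: "U x y \<le> L x y" if "y < N" for y
  proof -
    have "0 \<le> w y ^ y * (running_max x y - x y)"
      using running_max_ge[of x y] w(2)[of y] by (intro mult_nonneg_nonneg) auto
    then show ?thesis using f0[OF that] by (simp add: f_def)
  qed
  have L_le_U: "L x y \<le> U x y" if "y < N" for y
    using that
  proof (induction y)
    case 0
    then show ?case using f0[of 0] by (simp add: f_def)
  next
    case (Suc y)
    show ?case
    proof (cases "running_max x (Suc y) = x (Suc y)")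
      case True
      then show ?thesis using f0[of "Suc y"] Suc.prems by (simp add: f_def)
    next
      case False
      then have q0: "q x (Suc y) = 0"
        using Suc.prems by (auto simp: q_def max_def split: if_splits)
      have "L x (Suc y) \<le> w y * L x y"
        using moment_Suc_le[of w "q x" y] q_nonneg[OF x] w q0 by (simp add: L_def)
      also have "\<dots> \<le> w y * U x y"
        using Suc w(2)[of y] by simp
      also have "U x y = (\<Sum>i=Suc (Suc y)..N. q x i * w i ^ y)"
        unfolding U_def using q0 Suc.prems by (subst sum.atLeast_Suc_atMost) auto
      also have "w y * \<dots> \<le> U x (Suc y)"
        unfolding U_def sum_distrib_left
      proof (rule sum_mono)
        fix i assume "i \<in> {Suc (Suc y)..N}"
        then have "w y \<le> w i" using monoD[OF w(1)] by simp
        from mult_right_mono[OF this, of "q x i * w i ^ y"]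
        show "w y * (q x i * w i ^ y) \<le> q x i * w i ^ Suc y"
          using q_nonneg[OF x] w(2)[of i] by (simp add: mult_ac)
      qed
      finally show ?thesis .
    qed
  qed
  have balance: "L x y = U x y" if "y < N" for y
    using U_le_L[OF that] L_le_U[OF that] by simp
  have sum1: "(\<Sum>i\<le>N. q x i) = 1"
    using N sum_q[of "N - 1" x] by (cases N) (auto simp: q_def)
  \<comment> \<open>Balance at \<open>y = 0\<close> splits the total mass 1 into equal halves, and
    the left half is \<open>q x 0\<close> alone; so dividing by \<open>q x 0\<close> is
    legitimate.\<close>
  have pos: "0 < q x 0"
  proof (rule ccontr)
    assume "\<not> 0 < q x 0"
    then have "q x 0 = 0" using q_nonneg[OF x, of 0] by simp
    moreover have "{..N} = insert 0 {Suc 0..N}" using N by auto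
    ultimately have "(\<Sum>i\<le>N. q x i) = L x 0 + U x 0"
      by (simp add: L_def U_def)
    then have "L x 0 = 1 / 2" using sum1 balance[OF N] by simp
    then show False using \<open>q x 0 = 0\<close> by (simp add: L_def)
  qed
  show thesis
  proof (rule that[of "\<lambda>i. q x i / q x 0"])
    show "0 \<le> q x i / q x 0" for i using q_nonneg[OF x] pos by simp
    show "q x i / q x 0 = 0" if "N < i" for i using that by (simp add: q_def)
    show "q x 0 / q x 0 = 1" using pos by simp
    show "(\<Sum>i\<le>y. q x i / q x 0 * w i ^ y) = (\<Sum>i=Suc y..N. q x i / q x 0 * w i ^ y)" if "y < N" for y
      using balance[OF that] by (simp add: L_def U_def flip: sum_divide_distrib)
  qed
qed

section \<open>Passage from finitely to infinitely many points\<close>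

text \<open>Balance is restated as the whole series being twice its left part. Coordinatewise limits
  could lose mass at infinity; \<open>w_top\<close> and the uniform bound on the next moment prevent
  this.\<close>

theorem balanced_weights:
  fixes w :: "nat \<Rightarrow> real"
  assumes w: "mono w" "\<And>i. 0 < w i" and w_top: "filterlim w at_top sequentially"
  obtains q where "\<And>i. 0 \<le> q i" "q 0 = 1"
    "\<And>y. (\<lambda>i. q i * w i ^ y) sums (2 * (\<Sum>i\<le>y. q i * w i ^ y))"
    "\<And>y. (\<Sum>i\<le>y. q i * w i ^ y) \<le> (\<Prod>j<y. w j + w (Suc j))"
proof -
  define B where "B y = (\<Prod>j<y. w j + w (Suc j))" for y
  define L where "L q y = (\<Sum>i\<le>y. q i * w i ^ y)" for q :: "nat \<Rightarrow> real" and y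
  have "\<exists>q. (\<forall>i. 0 \<le> q i) \<and> (\<forall>i. Suc k < i \<longrightarrow> q i = 0) \<and> q 0 = 1 \<and>
      (\<forall>y<Suc k. L q y = (\<Sum>i=Suc y..Suc k. q i * w i ^ y))" for k
    by (rule finite_balanced_weights[OF w, of "Suc k"]) (auto simp: L_def)
  then obtain Q where Q_nonneg: "\<And>k i. 0 \<le> Q k i"
    and Q_zero: "\<And>k i. Suc k < i \<Longrightarrow> Q k i = 0" and Q0: "\<And>k. Q k 0 = 1"
    and Q_bal: "\<And>k y. y < Suc k \<Longrightarrow> L (Q k) y = (\<Sum>i=Suc y..Suc k. Q k i * w i ^ y)"
    by metis
  have term_nonneg: "0 \<le> Q k i * w i ^ y" for k i y
    using Q_nonneg[of k i] w(2)[of i] by simp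
  \<comment> \<open>Index \<open>Suc y\<close> is the first on the right side of the balance, so its
    single term is at most the left side; this supplies the \<open>w (Suc y)\<close> part of the
    growth factor.\<close>
  have term_le: "Q k (Suc y) * w (Suc y) ^ y \<le> L (Q k) y" if "y < Suc k" for k y
    unfolding Q_bal[OF that]
    by (rule member_le_sum[of _ _ "\<lambda>i. Q k i * w i ^ y"]) (use that term_nonneg in auto)
  have L_le: "L (Q k) y \<le> B y" if "y \<le> Suc k" for k y
    using that
  proof (induction y)
    case 0
    then show ?case by (simp add: L_def B_def Q0)
  next
    case (Suc y)
    have "L (Q k) (Suc y) \<le> w y * L (Q k) y + Q k (Suc y) * w (Suc y) ^ Suc y"
      using moment_Suc_le[OF w, of "Q k" y] Q_nonneg by (simp add: L_def)
    also have "\<dots> \<le> w y * L (Q k) y + w (Suc y) * L (Q k) y"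
      using mult_left_mono[OF term_le[of y k], of "w (Suc y)"] Suc.prems w(2)[of "Suc y"]
      by (simp add: mult_ac)
    also have "\<dots> = (w y + w (Suc y)) * L (Q k) y"
      by (simp add: algebra_simps)
    also have "\<dots> \<le> (w y + w (Suc y)) * B y"
      using Suc w(2)[of y] w(2)[of "Suc y"] by (intro mult_left_mono) auto
    finally show ?case by (simp add: B_def mult.commute)
  qed
  \<comment> \<open>Bounds independent of \<open>k\<close>, read off from \<open>term_le\<close> and
    \<open>L_le\<close>, confine all \<open>Q k\<close> to one compact box.\<close>
  define M where "M i = (case i of 0 \<Rightarrow> 1 | Suc y \<Rightarrow> B y / w (Suc y) ^ y)" for i
  have B_nonneg: "0 \<le> B y" for y
    using w(2) unfolding B_def by (intro prod_nonneg) (auto intro: add_nonneg_nonneg less_imp_le)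
  have "Q k i \<in> {0..M i}" for k i
  proof (cases i)
    case (Suc y)
    show ?thesis
    proof (cases "y < Suc k")
      case True
      then have "Q k (Suc y) * w (Suc y) ^ y \<le> B y"
        using term_le[of y k] L_le[of y k] by simp
      then show ?thesis using Suc Q_nonneg w(2)[of "Suc y"] by (simp add: M_def field_simps)
    next
      case False
      then show ?thesis using Suc Q_zero[of k i] B_nonneg[of y] w(2)[of "Suc y"] by (simp add: M_def)
    qed
  qed (simp add: Q0 M_def)
  from bounded_pointwise_convergent_subsequence[of Q, OF this]
  obtain q r where r: "strict_mono r" and q_bounds: "\<And>i. q i \<in> {0..M i}" and lim: "(Q \<circ> r) \<longlonglongrightarrow> q"
    by blast
  have lim_sum: "(\<lambda>k. \<Sum>i\<in>A. Q (r k) i * w i ^ y) \<longlonglongrightarrow> (\<Sum>i\<in>A. q i * w i ^ y)" for A y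
    using lim by (intro tendsto_intros) (auto simp: tendsto_pointwise_iff)
  have lim_L: "(\<lambda>k. L (Q (r k)) y) \<longlonglongrightarrow> L q y" for y
    unfolding L_def by (rule lim_sum)
  have ev_large: "\<forall>\<^sub>F k in sequentially. m \<le> r k" for m
    using filterlim_subseq[OF r] by (simp add: filterlim_at_top)
  \<comment> \<open>Tightness: the mass beyond \<open>m\<close> is controlled by the next moment.\<close>
  have partial_sum: "(\<Sum>i\<le>m. Q k i * w i ^ y) \<in> {2 * L (Q k) y - B (Suc y) / w m..2 * L (Q k) y}"
    if m: "Suc y \<le> m" "m \<le> k" for k m y
  proof -
    define T where "T = (\<Sum>i=Suc m..Suc k. Q k i * w i ^ y)"
    have split: "(\<Sum>i\<le>Suc k. Q k i * w i ^ y) = (\<Sum>i\<le>l. Q k i * w i ^ y) + (\<Sum>i=Suc l..Suc k. Q k i * w i ^ y)"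
      if "l \<le> k" for l
      using that by (subst sum.union_disjoint[symmetric]) (auto simp del: sum.atMost_Suc intro!: sum.cong)
    have "L (Q k) y + L (Q k) y = (\<Sum>i\<le>m. Q k i * w i ^ y) + T"
      using split[of y] split[of m] Q_bal[of y k] m unfolding T_def by (simp add: L_def)
    moreover have "0 \<le> T" unfolding T_def by (intro sum_nonneg term_nonneg)
    moreover have "w m * T \<le> B (Suc y)"
    proof -
      have "w m * T \<le> (\<Sum>i=Suc m..Suc k. Q k i * w i ^ Suc y)"
        unfolding T_def sum_distrib_left
      proof (rule sum_mono)
        fix i assume "i \<in> {Suc m..Suc k}"
        then have "w m \<le> w i" using monoD[OF w(1)] by simp
        from mult_right_mono[OF this, of "Q k i * w i ^ y"] term_nonneg
        show "w m * (Q k i * w i ^ y) \<le> Q k i * w i ^ Suc y" by (simp add: mult_ac)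
      qed
      also have "\<dots> \<le> (\<Sum>i=Suc (Suc y)..Suc k. Q k i * w i ^ Suc y)"
        using m by (intro sum_mono2 term_nonneg) auto
      also have "\<dots> \<le> B (Suc y)"
        using m L_le[of "Suc y" k] by (simp add: Q_bal)
      finally show ?thesis .
    qed
    then have "T \<le> B (Suc y) / w m"
      using w(2)[of m] by (simp add: field_simps)
    ultimately show ?thesis by simp
  qed
  \<comment> \<open>First \<open>k\<close> tends to infinity with \<open>m\<close> fixed, where only
    finite sums occur; afterwards \<open>m\<close> tends to infinity and the error
    \<open>B (Suc y) / w m\<close> vanishes.\<close>
  have sandwich: "(\<Sum>i\<le>m. q i * w i ^ y) \<in> {2 * L q y - B (Suc y) / w m..2 * L q y}"
    if m: "Suc y \<le> m" for m y
  proof -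
    have ev: "\<forall>\<^sub>F k in sequentially. (\<Sum>i\<le>m. Q (r k) i * w i ^ y) \<in>
        {2 * L (Q (r k)) y - B (Suc y) / w m..2 * L (Q (r k)) y}"
      using ev_large[of m] by eventually_elim (rule partial_sum[OF m])
    have "2 * L q y - B (Suc y) / w m \<le> (\<Sum>i\<le>m. q i * w i ^ y)"
      by (rule tendsto_le[OF _ lim_sum tendsto_diff[OF tendsto_mult_left[OF lim_L] tendsto_const]])
        (use ev in \<open>auto elim: eventually_mono\<close>)
    moreover have "(\<Sum>i\<le>m. q i * w i ^ y) \<le> 2 * L q y"
      by (rule tendsto_le[OF _ tendsto_mult_left[OF lim_L] lim_sum])
        (use ev in \<open>auto elim: eventually_mono\<close>)
    ultimately show ?thesis by simp
  qed
  have "(\<lambda>i. q i * w i ^ y) sums (2 * L q y)" for y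
  proof -
    have "(\<lambda>m. B (Suc y) / w m) \<longlonglongrightarrow> 0"
      by (rule tendsto_divide_0[OF tendsto_const filterlim_at_top_imp_at_infinity[OF w_top]])
    from tendsto_diff[OF tendsto_const this, of "2 * L q y"]
    have lower: "(\<lambda>m. 2 * L q y - B (Suc y) / w m) \<longlonglongrightarrow> 2 * L q y" by simp
    have ev: "\<forall>\<^sub>F m in sequentially. (\<Sum>i\<le>m. q i * w i ^ y) \<in>
        {2 * L q y - B (Suc y) / w m..2 * L q y}"
      using eventually_ge_at_top[of "Suc y"] by eventually_elim (rule sandwich)
    show ?thesis
      unfolding sums_def_le
      by (rule tendsto_sandwich[OF _ _ lower tendsto_const])
        (use ev in \<open>auto simp: eventually_conj_iff\<close>)
  qed
  moreover have "L q y \<le> B y" for y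
    by (rule tendsto_upperbound[OF lim_L])
      (use eventually_mono[OF ev_large[of y], of "\<lambda>k. L (Q (r k)) y \<le> B y"] L_le in auto)
  moreover have "q 0 = 1"
    using lim by (auto simp: tendsto_pointwise_iff Q0 dest!: spec[of _ 0] LIMSEQ_unique[OF tendsto_const])
  ultimately show thesis
    using q_bounds by (intro that[of q]) (auto simp: L_def B_def)
qed

section \<open>Positivity and normalisability of the weights\<close>

text \<open>If \<open>q (Suc z)\<close> vanished, passing from \<open>z\<close> to
  \<open>Suc z\<close> would multiply the left half by at most \<open>w z\<close> but the right half
  by at least \<open>w (Suc (Suc z))\<close>, so both balances could not hold. Positivity later
  makes the median exact: the mass strictly below \<open>w y\<close> stays under one half.\<close>

lemma balanced_weights_pos:
  fixes q w :: "nat \<Rightarrow> real"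
  assumes w: "strict_mono w" "\<And>i. 0 < w i" and q: "\<And>i. 0 \<le> q i" "0 < q 0"
    and bal: "\<And>y. (\<lambda>i. q i * w i ^ y) sums (2 * (\<Sum>i\<le>y. q i * w i ^ y))"
  shows "0 < q y"
proof (cases y)
  case (Suc z)
  define L where "L y = (\<Sum>i\<le>y. q i * w i ^ y)" for y
  let ?v = "w (Suc (Suc z))"
  have "q (Suc z) \<noteq> 0"
  proof
    assume q0: "q (Suc z) = 0"
    \<comment> \<open>Outside \<open>{..Suc z}\<close> these differences are nonnegative, since
      there \<open>w i\<close> is at least \<open>?v\<close>; hence the finite part is at most the
      total.\<close>
    define d where "d i = q i * w i ^ Suc z - ?v * (q i * w i ^ z)" for i
    have "d sums (2 * L (Suc z) - ?v * (2 * L z))"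
      unfolding d_def L_def by (intro sums_diff sums_mult bal)
    moreover have "0 \<le> d i" if "i \<notin> {..Suc z}" for i
    proof -
      have "?v \<le> w i" using that strict_mono_mono[OF w(1), THEN monoD] by simp
      from mult_right_mono[OF this, of "q i * w i ^ z"] show ?thesis
        using q(1)[of i] w(2)[of i] by (simp add: d_def mult_ac)
    qed
    ultimately have "sum d {..Suc z} \<le> 2 * L (Suc z) - ?v * (2 * L z)"
      using sum_le_suminf[of d "{..Suc z}"] by (auto simp: sums_iff)
    also have "sum d {..Suc z} = L (Suc z) - ?v * L z"
      using q0 by (simp add: d_def L_def sum_subtractf sum_distrib_left)
    finally have "?v * L z \<le> L (Suc z)" by (simp add: mult.commute)
    also have "L (Suc z) \<le> w z * L z"
      using moment_Suc_le[of w q z] strict_mono_mono[OF w(1)] w(2) q(1) q0 by (simp add: L_def)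
    finally have "(?v - w z) * L z \<le> 0" by (simp add: algebra_simps)
    moreover have "0 < L z"
      unfolding L_def using q w(2) by (intro sum_pos2[of _ 0]) (auto simp: less_imp_le)
    moreover have "w z < ?v" using w(1) by (simp add: strict_mono_less)
    ultimately show False by (simp add: mult_le_0_iff)
  qed
  then show ?thesis using q(1)[of y] Suc by (simp add: order_less_le)
qed (use q in simp)

text \<open>Finite partial sums over \<open>i\<close> can be exchanged with the exponential series,
  and nonnegativity bounds each of them by the series of \<open>M k / fact k\<close>. This makes the
  prior normalisable.\<close>

lemma summable_exp_of_moments:
  fixes q w M :: "nat \<Rightarrow> real"
  assumes q: "\<And>i. 0 \<le> q i" and w: "\<And>i. 0 \<le> w i"
    and moments: "\<And>k. (\<lambda>i. q i * w i ^ k) sums M k" and M: "summable (\<lambda>k. M k / fact k)"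
  shows "summable (\<lambda>i. q i * exp (w i))"
proof (rule summableI_nonneg_bounded)
  show "0 \<le> q i * exp (w i)" for i using q by simp
  fix m
  have "(\<lambda>k. q i * (w i ^ k /\<^sub>R fact k)) sums (q i * exp (w i))" for i
    by (intro sums_mult exp_converges)
  then have s: "(\<lambda>k. \<Sum>i<m. q i * (w i ^ k /\<^sub>R fact k)) sums (\<Sum>i<m. q i * exp (w i))"
    by (intro sums_sum)
  have "(\<Sum>i<m. q i * (w i ^ k /\<^sub>R fact k)) \<le> M k / fact k" for k
  proof -
    have "(\<Sum>i<m. q i * w i ^ k) \<le> M k"
      using sum_le_suminf[of "\<lambda>i. q i * w i ^ k" "{..<m}"] moments[of k] q w by (auto simp: sums_iff)
    from divide_right_mono[OF this, of "fact k"] show ?thesis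
      by (simp add: sum_divide_distrib) (simp add: divide_inverse mult_ac)
  qed
  from sums_le[OF this s summable_sums[OF M]]
  show "(\<Sum>i<m. q i * exp (w i)) \<le> (\<Sum>k. M k / fact k)" .
qed

section \<open>Discrete priors in the Poisson model\<close>

context
  fixes p :: "nat pmf" and w :: "nat \<Rightarrow> real" and P :: "real measure"
  assumes w: "\<And>i. 0 \<le> w i"
  defines "P \<equiv> distr (measure_pmf p) borel w"
begin

text \<open>Pushing forward along \<open>w\<close> turns the slice integral into a series over
  indices; summability keeps it finite, so it passes from \<open>ennreal\<close> to
  \<open>real\<close>.\<close>

lemma measure_poisson_joint_distr_pmf:
  assumes A: "A \<in> sets borel" and summable: "summable (\<lambda>i. pmf p i * poisson_likelihood y (w i))"
  shows "measure (poisson_joint P) (A \<times> {y}) =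
    (\<Sum>i. pmf p i * poisson_likelihood y (w i) * indicator A (w i))"
proof -
  have nonneg: "0 \<le> pmf p i * poisson_likelihood y (w i) * indicator B (w i)" for i and B :: "real set"
    by (simp add: poisson_likelihood_nonneg[OF w])
  have P: "prob_space P" "sets P = sets borel"
    by (auto simp: P_def intro!: prob_space.prob_space_distr prob_space_measure_pmf)
  have [measurable]: "(\<lambda>x. ennreal (poisson_likelihood y x)) \<in> borel_measurable borel"
    unfolding poisson_likelihood_def by measurable
  note [measurable] = A
  have s: "summable (\<lambda>i. pmf p i * poisson_likelihood y (w i) * indicator A (w i))"
    by (rule summable_comparison_test'[OF summable]) 
      (use nonneg[of _ UNIV] in \<open>auto simp: indicator_def\<close>)
  have "emeasure (poisson_joint P) (A \<times> {y}) =
      (\<integral>\<^sup>+ i. ennreal (poisson_likelihood y (w i)) * indicator A (w i) \<partial>measure_pmf p)"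
    unfolding emeasure_poisson_joint_slice[OF P A] unfolding P_def by (subst nn_integral_distr) auto
  also have "\<dots> = (\<integral>\<^sup>+ i. ennreal (pmf p i * poisson_likelihood y (w i) * indicator A (w i)) \<partial>count_space UNIV)"
    unfolding nn_integral_measure_pmf
    by (intro nn_integral_cong) (auto simp: ennreal_mult' indicator_def)
  also have "\<dots> = ennreal (\<Sum>i. pmf p i * poisson_likelihood y (w i) * indicator A (w i))"
    unfolding nn_integral_count_space_nat by (rule suminf_ennreal2[OF nonneg s])
  finally show ?thesis
    using suminf_nonneg[OF s nonneg] by (simp add: measure_def)
qed

text \<open>Bayes' rule: numerator and denominator are the masses of the slices
  \<open>{..t} \<times> {y}\<close> and \<open>UNIV \<times> {y}\<close>.\<close>

lemma cond_cdf_poisson_joint_distr_pmf: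
  assumes "summable (\<lambda>i. pmf p i * poisson_likelihood y (w i))"
  shows "cond_cdf (poisson_joint P) fst snd y t =
    (\<Sum>i. pmf p i * poisson_likelihood y (w i) * indicator {..t} (w i)) /
    (\<Sum>i. pmf p i * poisson_likelihood y (w i))"
proof -
  have "space (poisson_joint P) = UNIV"
    by (simp add: poisson_joint_def space_pair_measure P_def)
  then have "cond_cdf (poisson_joint P) fst snd y t =
      measure (poisson_joint P) ({..t} \<times> {y}) / measure (poisson_joint P) (UNIV \<times> {y})"
    unfolding cond_cdf_def cond_prob_def
    by (intro arg_cong2[where f = "(/)"] arg_cong[where f = "measure _"]) auto
  then show ?thesis
    using measure_poisson_joint_distr_pmf[OF _ assms, of "{..t}"]
      measure_poisson_joint_distr_pmf[OF _ assms, of UNIV] by simp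
qed

end

section \<open>From balanced weights to prescribed medians\<close>

lemma quantile_eqI:
  assumes "\<And>t. m \<le> t \<Longrightarrow> p \<le> F t" "\<And>t. t < m \<Longrightarrow> F t < p"
  shows "quantile F p = m"
proof -
  have "{t. p \<le> F t} = {m..}"
    using assms by (auto simp: not_le[symmetric])
  then show ?thesis by (simp add: quantile_def)
qed

text \<open>Giving \<open>w i\<close> prior mass proportional to \<open>q i * exp (w i)\<close>
  cancels the factor \<open>exp (- w i)\<close> of the likelihood. The posterior is then
  proportional to \<open>q i * w i ^ y\<close>, and balance puts exactly half of it on the indices
  up to \<open>y\<close>. The summability assumption keeps the normaliser finite.\<close>

theorem exists_prior_with_medians:
  fixes w :: "nat \<Rightarrow> real"
  assumes w: "strict_mono w" "\<And>i. 0 < w i" and w_top: "filterlim w at_top sequentially"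
    and summable: "summable (\<lambda>k. (\<Prod>j<k. w j + w (Suc j)) / fact k)"
  obtains P :: "real measure" where "prob_space P" "sets P = sets borel" "measure P (range w) = 1"
    "\<And>y. cond_median (poisson_joint P) fst snd y = w y"
proof -
  obtain q where q: "\<And>i. 0 \<le> q i" "q 0 = 1"
    and bal: "\<And>y. (\<lambda>i. q i * w i ^ y) sums (2 * (\<Sum>i\<le>y. q i * w i ^ y))"
    and L_le: "\<And>y. (\<Sum>i\<le>y. q i * w i ^ y) \<le> (\<Prod>j<y. w j + w (Suc j))"
    by (rule balanced_weights[OF strict_mono_mono[OF w(1)] w(2) w_top]) auto
  have q_pos: "0 < q y" for y
    by (rule balanced_weights_pos[OF w q(1) _ bal]) (simp add: q)
  define L where "L y = (\<Sum>i\<le>y. q i * w i ^ y)" for y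
  have L_pos: "0 < L y" for y
    unfolding L_def using q_pos w(2) by (intro sum_pos) auto
  have "summable (\<lambda>k. 2 * L k / fact k)"
    by (rule summable_comparison_test'[OF summable_mult[OF summable, of 2]])
      (use L_le L_pos in \<open>auto simp: L_def abs_of_pos divide_right_mono less_imp_le\<close>)
  then have sq: "summable (\<lambda>i. q i * exp (w i))"
    using summable_exp_of_moments[OF q(1) _ bal] w(2) by (auto simp: L_def less_imp_le)
  define Z where "Z = (\<Sum>i. q i * exp (w i))"
  have Z_pos: "0 < Z"
    unfolding Z_def using q_pos by (intro suminf_pos sq) auto
  define p where "p = embed_pmf (\<lambda>i. q i * exp (w i) / Z)"
  have pmf_p: "pmf p i = q i * exp (w i) / Z" for i
    unfolding p_def
  proof (rule pmf_embed_pmf)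
    show "0 \<le> q i * exp (w i) / Z" for i using q Z_pos by simp
    have "(\<lambda>i. q i * exp (w i) / Z) sums 1"
      using sums_divide[OF summable_sums[OF sq], of Z] Z_pos by (simp add: Z_def)
    then show "(\<integral>\<^sup>+ i. ennreal (q i * exp (w i) / Z) \<partial>count_space UNIV) = 1"
      using q Z_pos by (simp add: nn_integral_count_space_nat suminf_ennreal2 sums_iff)
  qed
  define P where "P = distr (measure_pmf p) borel w"
  have "cond_median (poisson_joint P) fst snd y = w y" for y
  proof -
    \<comment> \<open>Collects the factors independent of \<open>i\<close>; it cancels in the
      conditional distribution function.\<close>
    define c where "c = 1 / (Z * fact y)"
    have c: "0 < c" using Z_pos by (simp add: c_def)
    have lik: "pmf p i * poisson_likelihood y (w i) = c * (q i * w i ^ y)" for i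
      by (simp add: pmf_p poisson_likelihood_def c_def exp_minus field_simps)
    note sm = sums_summable[OF bal[of y]]
    define S where "S t = (\<Sum>i. q i * w i ^ y * indicator {..t} (w i))" for t
    have term_nonneg: "0 \<le> q i * w i ^ y" for i
      using q(1)[of i] w(2)[of i] by simp
    have s: "summable (\<lambda>i. q i * w i ^ y * indicator {..t} (w i))" for t
      by (rule summable_comparison_test'[OF sm]) (use term_nonneg in \<open>auto simp: indicator_def\<close>)
    have cdf: "cond_cdf (poisson_joint P) fst snd y t = S t / (2 * L y)" for t
    proof -
      have "cond_cdf (poisson_joint P) fst snd y t = (c * S t) / (c * (2 * L y))"
        unfolding P_def S_def using w(2) bal[of y] s[of t] sm
        by (subst cond_cdf_poisson_joint_distr_pmf)
          (auto simp: lik mult.assoc suminf_mult summable_mult sums_iff L_def less_imp_le)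
      then show ?thesis using c by simp
    qed
    have "quantile (cond_cdf (poisson_joint P) fst snd y) (1 / 2) = w y"
    proof (rule quantile_eqI)
      fix t assume t: "w y \<le> t"
      have "L y = (\<Sum>i\<le>y. q i * w i ^ y * indicator {..t} (w i))"
        unfolding L_def
      proof (intro sum.cong refl)
        fix i assume "i \<in> {..y}"
        then have "w i \<le> t" using t w(1) by (auto simp: strict_mono_less_eq intro: order_trans[of _ "w y"])
        then show "q i * w i ^ y = q i * w i ^ y * indicator {..t} (w i)" by simp
      qed
      also have "\<dots> \<le> S t"
        unfolding S_def using term_nonneg by (intro sum_le_suminf s) (auto simp: indicator_def)
      finally show "1 / 2 \<le> cond_cdf (poisson_joint P) fst snd y t"
        using L_pos[of y] by (simp add: cdf field_simps)
    next
      fix t assume t: "t < w y"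
      have "S t = (\<Sum>i<y. q i * w i ^ y * indicator {..t} (w i))"
        unfolding S_def
      proof (rule suminf_finite)
        fix i assume "i \<notin> {..<y}"
        then have "t < w i" using t w(1) by (auto simp: strict_mono_less_eq intro: less_le_trans)
        then show "q i * w i ^ y * indicator {..t} (w i) = 0" by simp
      qed simp
      also have "\<dots> \<le> (\<Sum>i<y. q i * w i ^ y)"
        using term_nonneg by (intro sum_mono) (auto simp: indicator_def)
      \<comment> \<open>The omitted term at \<open>i = y\<close> is positive, which makes the
        inequality strict.\<close>
      also have "\<dots> < L y"
        using q_pos[of y] w(2)[of y] by (simp add: L_def lessThan_Suc_atMost[symmetric])
      finally show "cond_cdf (poisson_joint P) fst snd y t < 1 / 2"
        using L_pos[of y] by (simp add: cdf field_simps)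
    qed
    then show ?thesis by (simp add: cond_median_def)
  qed
  moreover have "measure P (range w) = 1"
  proof -
    have "range w \<in> sets borel" by (rule sets.countable) auto
    then have "measure P (range w) = measure (measure_pmf p) (w -` range w)"
      unfolding P_def by (subst measure_distr) auto
    also have "w -` range w = UNIV" by auto
    finally show ?thesis by simp
  qed
  ultimately show thesis
    by (intro that[of P]) (auto simp: P_def intro!: prob_space.prob_space_distr prob_space_measure_pmf)
qed

section \<open>Affine support points\<close>

text \<open>Consecutive terms have ratio \<open>(a * k + b) / (k + 1)\<close>, which tends to
  \<open>a < 1\<close>.\<close>

lemma summable_affine_product_over_fact:
  fixes a b :: real
  assumes "0 \<le> a" "a < 1" "0 \<le> b"
  shows "summable (\<lambda>k. (\<Prod>j<k. a * real j + b) / fact k)"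
proof -
  obtain c where c: "a < c" "c < 1" using assms dense by blast
  \<comment> \<open>From \<open>b / (c - a)\<close> on, \<open>a * k + b \<le> c * k\<close>, so the
    ratio is at most \<open>c\<close>.\<close>
  obtain N :: nat where N: "b / (c - a) \<le> real N" using real_arch_simple by blast
  show ?thesis
  proof (rule summable_ratio_test[OF c(2)])
    fix k assume "N \<le> k"
    then have "b / (c - a) \<le> real k" using N by linarith
    then have "b \<le> (c - a) * real k" using c by (simp add: field_simps)
    then have le: "a * real k + b \<le> c * real (Suc k)"
      using c assms by (simp add: algebra_simps)
    define T where "T k = (\<Prod>j<k. a * real j + b) / fact k" for k
    have T: "0 \<le> T k" for k
      using assms by (auto simp: T_def intro!: prod_nonneg divide_nonneg_nonneg add_nonneg_nonneg)
    have "T (Suc k) = T k * ((a * real k + b) / real (Suc k))"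
      by (simp add: T_def)
    also have "\<dots> \<le> T k * c"
      using le T by (intro mult_left_mono) (auto simp: divide_simps)
    finally show "norm ((\<Prod>j<Suc k. a * real j + b) / fact (Suc k)) \<le> c * norm ((\<Prod>j<k. a * real j + b) / fact k)"
      using T[of k] T[of "Suc k"] unfolding T_def[symmetric] by (simp add: mult.commute)
  qed
qed

text \<open>For these points \<open>w j + w (Suc j)\<close> is affine in \<open>j\<close> with slope
  \<open>2 * a\<close>, and \<open>a < 1 / exp 1\<close> together with \<open>2 \<le> exp 1\<close>
  puts this slope below 1.\<close>

theorem corollary1:
  fixes a b :: real and W :: "real set"
  assumes "0 < a" "a < 1 / exp 1" "0 < b"
    and "W = {w. \<exists>i::nat. i \<ge> 1 \<and> w = a * (real i - 1) + b}"
  shows "\<exists>P :: real measure. prob_space P \<and> sets P = sets borel \<and> measure P W = 1 \<and>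
    (\<forall>y::nat. cond_median (poisson_joint P) fst snd y = a * real y + b)"
proof -
  define w where "w i = a * real i + b" for i
  have "2 \<le> exp (1 :: real)" using exp_ge_add_one_self[of 1] by simp
  then have "1 / exp 1 \<le> (1 / 2 :: real)" by (intro divide_left_mono) auto
  then have a: "2 * a < 1" using assms(2) by linarith
  have sum: "w j + w (Suc j) = (2 * a) * real j + (a + 2 * b)" for j
    by (simp add: w_def algebra_simps)
  \<comment> \<open>The indices of \<open>W\<close> start at 1, those of \<open>w\<close> at
    0.\<close>
  have W: "W = range w"
  proof (intro set_eqI iffI)
    fix x assume "x \<in> W"
    then obtain i :: nat where "i \<ge> 1" "x = a * (real i - 1) + b" using assms(4) by auto
    then have "x = w (i - 1)" by (simp add: w_def of_nat_diff)
    then show "x \<in> range w" by simp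
  next
    fix x assume "x \<in> range w"
    then obtain j where "x = a * (real (Suc j) - 1) + b" by (auto simp: w_def)
    then show "x \<in> W" using assms(4) by force
  qed
  have "filterlim (\<lambda>i. b + a * real i) at_top sequentially"
    using assms(1)
    by (intro filterlim_tendsto_add_at_top[OF tendsto_const]
        filterlim_tendsto_pos_mult_at_top[OF tendsto_const] filterlim_real_sequentially)
  then have w_top: "filterlim w at_top sequentially"
    by (simp add: w_def[abs_def] add.commute)
  have "strict_mono w" "0 < w i" for i
    using assms(1,3) by (auto simp: w_def strict_mono_def intro!: add_nonneg_pos)
  moreover have "summable (\<lambda>k. (\<Prod>j<k. w j + w (Suc j)) / fact k)"
    unfolding sum using assms(1,3) a by (intro summable_affine_product_over_fact) auto
  ultimately obtain P :: "real measure" where "prob_space P" "sets P = sets borel"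
    "measure P (range w) = 1" "\<And>y. cond_median (poisson_joint P) fst snd y = w y"
    using exists_prior_with_medians w_top by blast
  then show ?thesis
    unfolding W by (intro exI[of _ P]) (simp add: w_def)
qed

end
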